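(* Let $\mathcal H$ be a real Hilbert space and let $B\colon\mathcal H\to\mathcal H$ be monotone and $L$-Lipschitz ($L>0$), not necessarily affine or differentiable, with $S=B^{-1}(0)\neq\varnothing$. Consider the pure reflected scheme $$x_{k+1}=x_k-\lambda B(u_k),\qquad u_k=2x_k-x_{k-1}.$$ (a) (Sharpness) For the rotation $B=LJ$ on $\mathbb R^2$ and every $\lambda>1/(\sqrt3\,L)$ the iterates diverge for generic initial data; hence no universal constant $c$ (such that the scheme converges for all $B$ in the class and all $\lambda<c/L$) can exceed $1/\sqrt3$. (b) (Conditional convergence) For every $0<\lambda<1/(\sqrt3\,L)$, every trajectory of the scheme with $\sum_k\|B(u_k)\|^2<\infty$ converges weakly to a point of $S$, with $\|x_{k+1}-x_k\|\to0$ and $B(x_k)\to0$.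
   Context: Monotone means $\langle B(x)-B(y),x-y\rangle\ge0$ for all $x,y\in\mathcal H$; $L$-Lipschitz means $\|B(x)-B(y)\|\le L\|x-y\|$. $J$ is the counterclockwise rotation by $\pi/2$ on $\mathbb R^2$. The scheme is started from $x_0,x_{-1}\in\mathcal H$. "Generic initial data" means all initial data outside a proper linear subspace of the space of initial data. *)

theory Defs
  imports "HOL-Analysis.Analysis"
begin

definition monotone_operator :: "('a::real_inner \<Rightarrow> 'a) \<Rightarrow> bool" where
  "monotone_operator B \<longleftrightarrow> (\<forall>x y. (B x - B y) \<bullet> (x - y) \<ge> 0)"

definition mono_lip_class :: "real \<Rightarrow> ('a::{real_inner, complete_space} \<Rightarrow> 'a) set" where
  "mono_lip_class L = {B. monotone_operator B \<and> L-lipschitz_on UNIV B \<and> {z. B z = 0} \<noteq> {}}"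

(* A trajectory is given by the sequence x 0, x 1, ... together with the extra starting
   point xm, which plays the role of x_{-1}. *)

definition reflected_point :: "'a::real_vector \<Rightarrow> (nat \<Rightarrow> 'a) \<Rightarrow> nat \<Rightarrow> 'a" where
  "reflected_point xm x k = 2 *\<^sub>R x k - (case k of 0 \<Rightarrow> xm | Suc j \<Rightarrow> x j)"

definition reflected_trajectory ::
  "('a::real_vector \<Rightarrow> 'a) \<Rightarrow> real \<Rightarrow> 'a \<Rightarrow> (nat \<Rightarrow> 'a) \<Rightarrow> bool" where
  "reflected_trajectory B lam xm x \<longleftrightarrow>
     (\<forall>k. x (Suc k) = x k - lam *\<^sub>R B (reflected_point xm x k))"

definition weakly_converges :: "(nat \<Rightarrow> 'a::real_inner) \<Rightarrow> 'a \<Rightarrow> bool" where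
  "weakly_converges x p \<longleftrightarrow> (\<forall>y. (\<lambda>k. x k \<bullet> y) \<longlonglongrightarrow> p \<bullet> y)"

definition rotJ :: "real^2 \<Rightarrow> real^2" where
  "rotJ v = vector [- (v $ 2), v $ 1]"

end

theory Submission
  imports Defs
begin

text \<open>
  Sharpness: identifying the plane with the complex numbers, the rotation scheme is the linear
  recurrence with characteristic polynomial \<open>r\<^sup>2 - (1 - 2is) r - is\<close>, \<open>s = \<lambda>L\<close>. For
  \<open>s > 1/\<surd>3\<close> its roots lie on opposite sides of the unit circle, so every solution off the line
  of the small root diverges.

  Convergence: as \<open>x\<^bsub>k+1\<^esub> - x\<^bsub>k\<^esub> = -\<lambda> B(u\<^bsub>k\<^esub>)\<close> is square summable, monotonicity makes the
  trajectory quasi-Fejer with respect to the zero set, and \<open>B(x\<^bsub>k\<^esub>) \<rightarrow> 0\<close>. An Opial argument then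
  applies. Weak sequential compactness is replaced by a weaker tool: nested bounded closed convex
  sets intersect, which yields a point in all closed convex hulls of the tails of any subsequence;
  Minty's trick shows that it is a zero of \<open>B\<close>.
\<close>

section \<open>Half-space limits in Hilbert spaces\<close>

text \<open>The distances \<open>r n\<close> from 0 to \<open>C n\<close> increase to a finite
  limit. By the parallelogram identity, points of \<open>C n\<close> of almost minimal norm then
  form a Cauchy sequence, and its limit lies in every \<open>C n\<close>.\<close>

lemma nested_closed_convex_nonempty:
  fixes C :: "nat \<Rightarrow> 'a::{real_inner, complete_space} set"
  assumes cl: "\<And>n. closed (C n)" and cv: "\<And>n. convex (C n)" and ne: "\<And>n. C n \<noteq> {}"
    and dec: "decseq C" and bd: "bounded (C 0)"
  shows "(\<Inter>n. C n) \<noteq> {}"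
proof -
  define r where "r n = infdist 0 (C n)" for n
  have r_le: "r n \<le> norm z" if "z \<in> C n" for n z
    using infdist_le[OF that, of 0] by (simp add: r_def)
  have r0: "r n \<ge> 0" for n by (simp add: r_def infdist_nonneg)
  have sub: "C m \<subseteq> C n" if "n \<le> m" for n m
    using dec that by (auto simp: decseq_def)
  have "incseq r"
    unfolding incseq_def r_def using sub ne by (auto intro!: infdist_mono)
  obtain M where M: "\<And>z. z \<in> C 0 \<Longrightarrow> norm z \<le> M"
    using bd by (auto simp: bounded_iff)
  have "r n \<le> M" for n
    using ne[of n] r_le[of _ n] M sub[of 0 n] by (meson ex_in_conv le0 order_trans subsetD)
  then obtain R where R: "r \<longlonglongrightarrow> R"
    using \<open>incseq r\<close> incseq_convergent by blast
  have rR: "r n \<le> R" for n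
    using \<open>incseq r\<close> R incseq_le by blast
  have "\<exists>z\<in>C n. norm z < r n + 1 / real (Suc n)" for n
  proof (rule ccontr)
    assume "\<not> ?thesis"
    then have "r n + 1 / real (Suc n) \<le> infdist 0 (C n)"
      unfolding infdist_notempty[OF ne] by (intro cINF_greatest[OF ne]) auto
    then show False by (simp add: r_def)
  qed
  then obtain z where z: "\<And>n. z n \<in> C n" and zr: "\<And>n. norm (z n) < r n + 1 / real (Suc n)"
    by metis
  \<comment> \<open>The parallelogram identity gives this bound: both norms are at most
    \<open>R + 1 / real (Suc n)\<close>, and the norm of the sum is at least
    \<open>2 * r n\<close>.\<close>
  define h where "h n = 4 * ((R + 1 / real (Suc n))\<^sup>2 - (r n)\<^sup>2)" for n
  have "(\<lambda>n. 4 * ((R + 1 / real (Suc n))\<^sup>2 - (r n)\<^sup>2)) \<longlonglongrightarrow> 4 * ((R + 0)\<^sup>2 - R\<^sup>2)"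
    by (intro tendsto_intros R LIMSEQ_Suc[OF lim_1_over_n])
  then have h: "h \<longlonglongrightarrow> 0" by (simp add: h_def[abs_def])
  have dist: "(norm (z m - z n))\<^sup>2 \<le> h n" if "n \<le> m" for m n
  proof -
    \<comment> \<open>Convexity enters here: the midpoint stays in \<open>C n\<close>, so its norm
      cannot fall below \<open>r n\<close>.\<close>
    have "(1/2) *\<^sub>R z m + (1/2) *\<^sub>R z n \<in> C n"
      using cv[of n] z[of n] z[of m] sub[OF that] by (auto simp: convex_def)
    then have "r n \<le> norm ((1/2) *\<^sub>R (z m + z n))"
      using r_le by (simp add: scaleR_add_right)
    then have "2 * r n \<le> norm (z m + z n)" by simp
    then have a: "4 * (r n)\<^sup>2 \<le> (norm (z m + z n))\<^sup>2"
      using power_mono[of "2 * r n" _ 2] r0[of n] by (simp add: power_mult_distrib)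
    have "1 / real (Suc m) \<le> 1 / real (Suc n)" using that by (simp add: frac_le)
    then have "norm (z m) \<le> R + 1 / real (Suc n)" "norm (z n) \<le> R + 1 / real (Suc n)"
      using zr[of m] zr[of n] rR[of m] rR[of n] by linarith+
    then have b: "(norm (z m))\<^sup>2 \<le> (R + 1 / real (Suc n))\<^sup>2"
        "(norm (z n))\<^sup>2 \<le> (R + 1 / real (Suc n))\<^sup>2"
      by (auto intro: power_mono)
    have "(norm (z m - z n))\<^sup>2 = 2 * (norm (z m))\<^sup>2 + 2 * (norm (z n))\<^sup>2 - (norm (z m + z n))\<^sup>2"
      by (simp add: power2_norm_eq_inner inner_diff inner_add inner_commute algebra_simps)
    then show ?thesis using a b unfolding h_def by argo
  qed
  have "Cauchy z"
  proof (rule metric_CauchyI)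
    fix e :: real assume "e > 0"
    then have "\<forall>\<^sub>F n in sequentially. h n < (e/2)\<^sup>2"
      using h by (intro order_tendstoD(2)) auto
    then obtain N where "h N < (e/2)\<^sup>2" by (auto simp: eventually_sequentially)
    then have *: "dist (z m) (z N) < e/2" if "m \<ge> N" for m
      using dist[OF that] \<open>e > 0\<close> power_less_imp_less_base[of "norm (z m - z N)" 2 "e/2"]
      by (simp add: dist_norm)
    have "dist (z m) (z n) < e" if "m \<ge> N" "n \<ge> N" for m n
      using *[OF that(1)] *[OF that(2)] dist_triangle_half_l by blast
    then show "\<exists>N. \<forall>m\<ge>N. \<forall>n\<ge>N. dist (z m) (z n) < e" by blast
  qed
  then obtain q where q: "z \<longlonglongrightarrow> q"
    using Cauchy_convergent_iff convergent_def by blast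
  have "q \<in> C n" for n
  proof (rule Lim_in_closed_set[OF cl _ _ q])
    show "\<forall>\<^sub>F k in sequentially. z k \<in> C n"
      using eventually_ge_at_top[of n] by eventually_elim (use z sub in blast)
  qed simp
  then show ?thesis by blast
qed

text \<open>A substitute for weak cluster points: every weak cluster point has this property. In a
  Hilbert space it amounts to lying in the closed convex hull of every tail.\<close>

definition halfspace_limit :: "(nat \<Rightarrow> 'a::real_inner) \<Rightarrow> 'a \<Rightarrow> bool" where
  "halfspace_limit x q \<longleftrightarrow> (\<forall>y a. (\<forall>\<^sub>F k in sequentially. x k \<bullet> y \<le> a) \<longrightarrow> q \<bullet> y \<le> a)"

text \<open>The closed convex hulls of the tails are nested and bounded, so they share a point. A
  closed half-space containing a tail also contains the hull of that tail.\<close>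

lemma halfspace_limit_exists:
  fixes x :: "nat \<Rightarrow> 'a::{real_inner, complete_space}"
  assumes "bounded (range x)"
  obtains q where "halfspace_limit x q"
proof -
  define C where "C n = closure (convex hull (x ` {n..}))" for n
  have "(\<Inter>n. C n) \<noteq> {}"
  proof (rule nested_closed_convex_nonempty)
    show "decseq C"
      unfolding decseq_def C_def by (auto intro!: closure_mono hull_mono)
    have "bounded (x ` {0..})" using assms by (rule bounded_subset) auto
    then show "bounded (C 0)"
      unfolding C_def by (intro bounded_closure bounded_convex_hull)
  qed (auto simp: C_def convex_closure)
  then obtain q where q: "\<And>n. q \<in> C n" by blast
  have "q \<bullet> y \<le> a" if ev: "\<forall>\<^sub>F k in sequentially. x k \<bullet> y \<le> a" for y a
  proof -
    obtain N where N: "\<forall>k\<ge>N. x k \<bullet> y \<le> a"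
      using ev unfolding eventually_sequentially by blast
    have "C N \<subseteq> {v. y \<bullet> v \<le> a}"
      unfolding C_def
      by (intro closure_minimal hull_minimal closed_halfspace_le convex_halfspace_le)
         (use N in \<open>auto simp: inner_commute[of y]\<close>)
    then show ?thesis using q[of N] by (auto simp: inner_commute)
  qed
  then show ?thesis using that by (auto simp: halfspace_limit_def)
qed

lemma halfspace_limit_le:
  assumes q: "halfspace_limit x q" and f: "f \<longlonglongrightarrow> l"
    and le: "\<forall>\<^sub>F k in sequentially. x k \<bullet> y \<le> f k"
  shows "q \<bullet> y \<le> l"
proof (rule field_le_epsilon)
  fix e :: real assume "e > 0"
  then have "\<forall>\<^sub>F k in sequentially. f k < l + e"
    using f by (intro order_tendstoD(2)) auto
  with le have "\<forall>\<^sub>F k in sequentially. x k \<bullet> y \<le> l + e"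
    by eventually_elim simp
  then show "q \<bullet> y \<le> l + e" using q by (auto simp: halfspace_limit_def)
qed

lemma halfspace_limit_eq:
  assumes q: "halfspace_limit x q" and l: "(\<lambda>k. x k \<bullet> y) \<longlonglongrightarrow> l"
  shows "q \<bullet> y = l"
proof (rule antisym)
  show "q \<bullet> y \<le> l" using halfspace_limit_le[OF q l] by simp
  have "q \<bullet> (- y) \<le> - l"
    using tendsto_minus[OF l] by (rule halfspace_limit_le[OF q]) simp
  then show "l \<le> q \<bullet> y" by simp
qed

text \<open>If \<open>x k \<bullet> y\<close> exceeded \<open>p \<bullet> y\<close> by a fixed
  amount infinitely often, a half-space limit \<open>q\<close> along those indices would also lie in
  \<open>S\<close>. Convergence of the distances to \<open>p\<close> and \<open>q\<close> forces
  \<open>p = q\<close>, which contradicts the excess.\<close>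

lemma opial_halfspace:
  fixes x :: "nat \<Rightarrow> 'a::{real_inner, complete_space}"
  assumes bd: "bounded (range x)"
    and conv: "\<And>p. p \<in> S \<Longrightarrow> convergent (\<lambda>k. (norm (x k - p))\<^sup>2)"
    and lim: "\<And>r q. strict_mono r \<Longrightarrow> halfspace_limit (x \<circ> r) q \<Longrightarrow> q \<in> S"
  shows "\<exists>p\<in>S. weakly_converges x p"
proof -
  obtain p where p: "halfspace_limit x p" using halfspace_limit_exists[OF bd] .
  have pS: "p \<in> S" using lim[of id] p by (simp add: strict_mono_def)
  have upper: "\<forall>\<^sub>F k in sequentially. x k \<bullet> y < p \<bullet> y + e" if "e > 0" for y e
  proof (rule ccontr)
    define A where "A = {k. x k \<bullet> y \<ge> p \<bullet> y + e}"
    assume "\<not> ?thesis"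
    then have "infinite A"
      by (simp add: A_def cofinite_eq_sequentially[symmetric] eventually_cofinite not_less)
    define r where "r = enumerate A"
    have r: "strict_mono r" unfolding r_def using \<open>infinite A\<close> by (rule strict_mono_enumerate)
    have rA: "x (r k) \<bullet> y \<ge> p \<bullet> y + e" for k
      using enumerate_in_set[OF \<open>infinite A\<close>, of k] by (simp add: r_def A_def)
    have "bounded (range (x \<circ> r))" using bd by (rule bounded_subset) auto
    then obtain q where q: "halfspace_limit (x \<circ> r) q" by (rule halfspace_limit_exists)
    have qS: "q \<in> S" using lim[OF r q] .
    \<comment> \<open>Polarization: the quadratic terms in \<open>x k\<close> cancel, so two
      convergent distances yield a convergent linear functional.\<close>
    have id: "x k \<bullet> (p - q)
        = ((norm (x k - q))\<^sup>2 - (norm (x k - p))\<^sup>2 + (norm p)\<^sup>2 - (norm q)\<^sup>2) / 2" for k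
      by (simp add: power2_norm_eq_inner inner_diff inner_commute algebra_simps)
    obtain a b where "(\<lambda>k. (norm (x k - q))\<^sup>2) \<longlonglongrightarrow> a" "(\<lambda>k. (norm (x k - p))\<^sup>2) \<longlonglongrightarrow> b"
      using conv[OF pS] conv[OF qS] by (auto simp: convergent_def)
    then have l: "(\<lambda>k. x k \<bullet> (p - q)) \<longlonglongrightarrow> (a - b + (norm p)\<^sup>2 - (norm q)\<^sup>2) / 2"
      unfolding id by (intro tendsto_intros) auto
    \<comment> \<open>The functional has the same limit along the whole sequence and along
      \<open>r\<close>, and half-space limits inherit it.\<close>
    have "p \<bullet> (p - q) = q \<bullet> (p - q)"
      using halfspace_limit_eq[OF p l] halfspace_limit_eq[OF q]
        LIMSEQ_subseq_LIMSEQ[OF l r] by (simp add: o_def)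
    then have "(p - q) \<bullet> (p - q) = 0" by (simp add: inner_diff_left)
    then have "p = q" by simp
    moreover have "q \<bullet> (- y) \<le> - (p \<bullet> y + e)"
      by (rule halfspace_limit_le[OF q tendsto_const]) (use rA in \<open>auto intro!: always_eventually simp: algebra_simps\<close>)
    ultimately show False using that by simp
  qed
  have "(\<lambda>k. x k \<bullet> y) \<longlonglongrightarrow> p \<bullet> y" for y
  proof (rule order_tendstoI)
    fix a assume "a < p \<bullet> y"
    \<comment> \<open>The lower estimate is the upper one in the direction
      \<open>- y\<close>.\<close>
    then show "\<forall>\<^sub>F k in sequentially. a < x k \<bullet> y"
      using upper[of "p \<bullet> y - a" "- y"] by simp
  next
    fix a assume "p \<bullet> y < a"
    then show "\<forall>\<^sub>F k in sequentially. x k \<bullet> y < a"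
      using upper[of "a - p \<bullet> y" y] by simp
  qed
  then show ?thesis using pS by (auto simp: weakly_converges_def)
qed

text \<open>Minty's trick: the inequality is tested at points approaching \<open>q\<close> along the
  direction \<open>- B q\<close>. Dividing out the step length and using continuity leaves
  \<open>B q \<bullet> (- B q) \<ge> 0\<close>.\<close>

lemma minty_zero:
  fixes B :: "'a::real_inner \<Rightarrow> 'a"
  assumes cont: "continuous_on UNIV B" and ge: "\<And>y. B y \<bullet> (y - q) \<ge> 0"
  shows "B q = 0"
proof -
  define g where "g n = q + (1 / real (Suc n)) *\<^sub>R (- B q)" for n
  have "g \<longlonglongrightarrow> q + 0 *\<^sub>R (- B q)"
    unfolding g_def by (intro tendsto_intros LIMSEQ_Suc[OF lim_1_over_n])
  then have "(\<lambda>n. B (g n)) \<longlonglongrightarrow> B q"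
    using continuous_on_tendsto_compose[OF cont] by auto
  then have lim: "(\<lambda>n. B (g n) \<bullet> (- B q)) \<longlonglongrightarrow> B q \<bullet> (- B q)"
    by (intro tendsto_intros)
  have "B (g n) \<bullet> (- B q) \<ge> 0" for n
    using ge[of "g n"] by (simp add: g_def divide_le_0_iff)
  then have "B q \<bullet> (- B q) \<ge> 0" using LIMSEQ_le_const[OF lim] by blast
  then show ?thesis by (metis inner_ge_zero inner_minus_right inner_eq_zero_iff neg_0_le_iff_le order_antisym)
qed

text \<open>For fixed \<open>y\<close>, monotonicity bounds \<open>x k \<bullet> B y\<close> by
  \<open>y \<bullet> B y\<close> plus an error that vanishes because \<open>B (x k)\<close> tends to
  0 on a bounded sequence. This is a half-space condition, so it passes to \<open>q\<close> and
  gives the hypothesis of Minty's trick.\<close>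

lemma monotone_halfspace_limit_zero:
  fixes B :: "'a::real_inner \<Rightarrow> 'a"
  assumes mono: "monotone_operator B" and cont: "continuous_on UNIV B"
    and bd: "bounded (range x)" and Bx: "(\<lambda>k. B (x k)) \<longlonglongrightarrow> 0" and q: "halfspace_limit x q"
  shows "B q = 0"
proof (rule minty_zero[OF cont])
  fix y
  obtain M where M: "\<And>k. norm (x k) \<le> M" using bd by (auto simp: bounded_iff)
  have "x k \<bullet> B y \<le> y \<bullet> B y + norm (B (x k)) * (norm y + M)" for k
  proof -
    have "(B y - B (x k)) \<bullet> (y - x k) \<ge> 0" using mono by (simp add: monotone_operator_def)
    then have le: "x k \<bullet> B y \<le> y \<bullet> B y - B (x k) \<bullet> (y - x k)"
      by (simp add: inner_diff inner_commute)
    have "- (B (x k) \<bullet> (y - x k)) \<le> norm (B (x k)) * norm (y - x k)"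
      using Cauchy_Schwarz_ineq2[of "B (x k)" "y - x k"] by linarith
    also have "\<dots> \<le> norm (B (x k)) * (norm y + M)"
      using norm_triangle_ineq4[of y "x k"] M[of k] by (intro mult_left_mono) auto
    finally have "- (B (x k) \<bullet> (y - x k)) \<le> norm (B (x k)) * (norm y + M)" .
    with le show ?thesis by linarith
  qed
  moreover have "(\<lambda>k. y \<bullet> B y + norm (B (x k)) * (norm y + M)) \<longlonglongrightarrow> y \<bullet> B y + 0 * (norm y + M)"
    by (intro tendsto_intros tendsto_norm_zero Bx)
  ultimately have "q \<bullet> B y \<le> y \<bullet> B y + 0 * (norm y + M)"
    using halfspace_limit_le[OF q] by auto
  then show "B y \<bullet> (y - q) \<ge> 0" by (simp add: inner_diff_right inner_commute)
qed

section \<open>Convergence of square-summable trajectories\<close>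

text \<open>Subtracting the partial sums of \<open>e\<close> leaves a decreasing sequence bounded
  below by \<open>- suminf e\<close>.\<close>

lemma convergent_quasi_decreasing:
  fixes a e :: "nat \<Rightarrow> real"
  assumes e: "summable e" "\<And>k. e k \<ge> 0" and a: "\<And>k. a k \<ge> 0"
    and step: "\<And>k. a (Suc k) \<le> a k + e k"
  shows "convergent a"
proof -
  define b where "b k = a k - (\<Sum>i<k. e i)" for k
  have "decseq b" unfolding decseq_Suc_iff b_def using step by (simp add: algebra_simps)
  moreover have "b k \<ge> - suminf e" for k
    using sum_le_suminf[OF e(1), of "{..<k}"] e(2) a[of k] by (simp add: b_def)
  ultimately obtain l where "b \<longlonglongrightarrow> l" using decseq_convergent by blast
  then have "(\<lambda>k. b k + (\<Sum>i<k. e i)) \<longlonglongrightarrow> l + suminf e"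
    using summable_LIMSEQ[OF e(1)] by (rule tendsto_add)
  then show ?thesis by (auto simp: b_def convergent_def)
qed

lemma reflected_summable_converges:
  fixes B :: "'a::{real_inner, complete_space} \<Rightarrow> 'a"
  assumes B: "B \<in> mono_lip_class L" and lam: "lam \<ge> 0"
    and traj: "reflected_trajectory B lam xm x"
    and summ: "summable (\<lambda>k. (norm (B (reflected_point xm x k)))\<^sup>2)"
  shows "\<exists>p\<in>{z. B z = 0}. weakly_converges x p"
    and "(\<lambda>k. norm (x (Suc k) - x k)) \<longlonglongrightarrow> 0"
    and "(\<lambda>k. B (x k)) \<longlonglongrightarrow> 0"
proof -
  have mono: "monotone_operator B" and lip: "L-lipschitz_on UNIV B" and ne: "{z. B z = 0} \<noteq> {}"
    using B by (auto simp: mono_lip_class_def)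
  define u where "u = reflected_point xm x"
  have d: "x (Suc k) - x k = - lam *\<^sub>R B (u k)" for k
    using traj by (simp add: reflected_trajectory_def u_def)
  \<comment> \<open>From index 1 on, \<open>u\<close> differs from \<open>x\<close> by the preceding
    step alone; the shift avoids the extra starting point \<open>xm\<close>. The Lipschitz bound can
    therefore carry smallness from \<open>B (u k)\<close> to \<open>B (x k)\<close>.\<close>
  have u: "u (Suc k) = x (Suc k) + (x (Suc k) - x k)" for k
    by (simp add: u_def reflected_point_def scaleR_2)
  have "(\<lambda>k. sqrt ((norm (B (u k)))\<^sup>2)) \<longlonglongrightarrow> sqrt 0"
    using summable_LIMSEQ_zero[OF summ] by (intro tendsto_real_sqrt) (simp add: u_def)
  then have Bu: "(\<lambda>k. norm (B (u k))) \<longlonglongrightarrow> 0" by simp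
  then have "(\<lambda>k. \<bar>lam\<bar> * norm (B (u k))) \<longlonglongrightarrow> 0" by (rule tendsto_mult_right_zero)
  then show dx: "(\<lambda>k. norm (x (Suc k) - x k)) \<longlonglongrightarrow> 0" by (simp add: d)
  have "(\<lambda>k. B (x (Suc k))) \<longlonglongrightarrow> 0"
  proof (rule tendsto_norm_zero_cancel, rule tendsto_sandwich[OF _ _ tendsto_const])
    show "(\<lambda>k. L * norm (x (Suc k) - x k) + norm (B (u (Suc k)))) \<longlonglongrightarrow> 0"
      by (intro tendsto_add_zero tendsto_mult_right_zero dx LIMSEQ_Suc[OF Bu])
    have "norm (B (x (Suc k))) \<le> L * norm (x (Suc k) - x k) + norm (B (u (Suc k)))" for k
    proof -
      have "dist (B (x (Suc k))) (B (u (Suc k))) \<le> L * dist (x (Suc k)) (u (Suc k))"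
        using lip by (rule lipschitz_onD) auto
      then have "norm (B (x (Suc k)) - B (u (Suc k))) \<le> L * norm (x (Suc k) - x k)"
        unfolding u by (simp add: dist_norm norm_minus_commute)
      then show ?thesis
        using norm_triangle_sub[of "B (x (Suc k))" "B (u (Suc k))"] by linarith
    qed
    then show "\<forall>\<^sub>F k in sequentially. norm (B (x (Suc k)))
        \<le> L * norm (x (Suc k) - x k) + norm (B (u (Suc k)))" by simp
  qed simp
  then show Bx: "(\<lambda>k. B (x k)) \<longlonglongrightarrow> 0" by (rule LIMSEQ_imp_Suc)
  have conv: "convergent (\<lambda>k. (norm (x k - p))\<^sup>2)" if "p \<in> {z. B z = 0}" for p
  proof -
    define n where "n k = norm (B (u k))" for k
    \<comment> \<open>In the notation \<open>b\<close>, \<open>c\<close>, \<open>v\<close> below,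
      expanding the square produces \<open>lam^2 |b|^2 - 2 lam (b \<bullet> v)\<close>. Monotonicity
      replaces the last term by \<open>- 2 lam^2 (b \<bullet> c)\<close>, which is at most
      \<open>lam^2 (|b|^2 + |c|^2)\<close>; the total is \<open>e k\<close>.\<close>
    define e where "e k = lam\<^sup>2 * (2 * (n (Suc k))\<^sup>2 + (n k)\<^sup>2)" for k
    have s: "summable (\<lambda>k. (n k)\<^sup>2)" using summ by (simp add: n_def u_def)
    have se: "summable e"
      unfolding e_def
      by (intro summable_mult summable_add s summable_Suc_iff[where f = "\<lambda>k. (n k)\<^sup>2", THEN iffD2])
    have "(norm (x (Suc (Suc k)) - p))\<^sup>2 \<le> (norm (x (Suc k) - p))\<^sup>2 + e k" for k
    proof -
      define v b c where "v = x (Suc k) - p" and "b = B (u (Suc k))" and "c = B (u k)"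
      have eq: "x (Suc (Suc k)) - p = v - lam *\<^sub>R b"
        using d[of "Suc k"] by (simp add: v_def b_def algebra_simps)
      have sq: "(norm (x (Suc (Suc k)) - p))\<^sup>2
          = (norm v)\<^sup>2 - 2 * (lam * (b \<bullet> v)) + lam\<^sup>2 * (norm b)\<^sup>2"
        unfolding eq power2_norm_eq_inner
        by (simp add: inner_diff inner_commute power2_eq_square algebra_simps)
      have "u (Suc k) - p = v - lam *\<^sub>R c"
        using u[of k] d[of k] by (simp add: v_def c_def algebra_simps)
      \<comment> \<open>Monotonicity is used between the reflected point and the zero
        \<open>p\<close>, where \<open>B p\<close> vanishes.\<close>
      moreover have "(b - B p) \<bullet> (u (Suc k) - p) \<ge> 0"
        using mono by (simp add: monotone_operator_def b_def)
      ultimately have "lam * (b \<bullet> c) \<le> b \<bullet> v"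
        using that by (simp add: inner_diff_right)
      then have "lam * (lam * (b \<bullet> c)) \<le> lam * (b \<bullet> v)"
        using lam by (rule mult_left_mono)
      \<comment> \<open>Young's inequality for the cross term, in the form of a nonnegative
        square.\<close>
      moreover have "lam\<^sup>2 * (norm (b + c))\<^sup>2 \<ge> 0" by simp
      then have "lam\<^sup>2 * (norm b)\<^sup>2 + lam\<^sup>2 * (norm c)\<^sup>2 + 2 * (lam * (lam * (b \<bullet> c))) \<ge> 0"
        unfolding power2_norm_eq_inner
        by (simp add: inner_add inner_commute power2_eq_square algebra_simps)
      moreover have "e k = 2 * (lam\<^sup>2 * (norm b)\<^sup>2) + lam\<^sup>2 * (norm c)\<^sup>2"
        by (simp add: e_def n_def b_def c_def algebra_simps)
      ultimately show ?thesis unfolding sq v_def[symmetric] by linarith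
    qed
    then have "convergent (\<lambda>k. (norm (x (Suc k) - p))\<^sup>2)"
      by (intro convergent_quasi_decreasing[OF se]) (auto simp: e_def)
    then show ?thesis by (simp add: convergent_Suc_iff[where f = "\<lambda>k. (norm (x k - p))\<^sup>2"])
  qed
  \<comment> \<open>Convergence of the distance to a single zero already bounds the
    trajectory.\<close>
  obtain p where p: "p \<in> {z. B z = 0}" using ne by blast
  have "Bseq (\<lambda>k. (norm (x k - p))\<^sup>2)" using conv[OF p] by (rule convergent_imp_Bseq)
  then obtain K where K: "\<And>k. (norm (x k - p))\<^sup>2 \<le> K" by (auto simp: Bseq_def)
  have "norm (x k) \<le> norm p + sqrt K" for k
    using real_le_rsqrt[OF K[of k]] norm_triangle_sub[of "x k" p] by linarith
  then have bd: "bounded (range x)" by (auto simp: bounded_iff)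
  have cont: "continuous_on UNIV B" using lip by (rule lipschitz_on_continuous_on)
  show "\<exists>p\<in>{z. B z = 0}. weakly_converges x p"
  proof (rule opial_halfspace[OF bd conv])
    fix r q assume r: "strict_mono (r :: nat \<Rightarrow> nat)" and q: "halfspace_limit (x \<circ> r) q"
    have "bounded (range (x \<circ> r))" using bd by (rule bounded_subset) auto
    moreover have "(\<lambda>k. B ((x \<circ> r) k)) \<longlonglongrightarrow> 0"
      using LIMSEQ_subseq_LIMSEQ[OF Bx r] by (simp add: o_def)
    ultimately have "B q = 0" using monotone_halfspace_limit_zero[OF mono cont] q by blast
    then show "q \<in> {z. B z = 0}" by simp
  qed
qed

section \<open>Divergence for the rotation\<close>

text \<open>The combinations \<open>y (Suc k) - b * y k\<close> and
  \<open>y (Suc k) - a * y k\<close> are geometric with ratios \<open>a\<close> and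
  \<open>b\<close>. Their difference is \<open>(a - b) * y k\<close>: one part grows, since
  \<open>init\<close> makes its coefficient nonzero, and the other stays bounded.\<close>

lemma second_order_recurrence_diverges:
  fixes y :: "nat \<Rightarrow> 'a::real_normed_field"
  assumes rec: "\<And>k. y (Suc (Suc k)) = (a + b) * y (Suc k) - a * b * y k"
    and a: "norm a > 1" and b: "norm b \<le> 1" and init: "y 1 \<noteq> b * y 0"
  shows "filterlim (\<lambda>k. norm (y k)) at_top sequentially"
proof -
  \<comment> \<open>Stated for arbitrary \<open>c\<close> and \<open>d\<close> so that it serves
    both orderings of the two roots.\<close>
  have geom: "y (Suc k) - d * y k = c ^ k * (y 1 - d * y 0)"
    if "\<And>k. y (Suc (Suc k)) = (c + d) * y (Suc k) - c * d * y k" for c d k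
  proof (induction k)
    case (Suc k)
    have "y (Suc (Suc k)) - d * y (Suc k) = c * (y (Suc k) - d * y k)"
      by (simp add: that algebra_simps)
    then show ?case by (simp add: Suc.IH)
  qed simp
  have w: "y (Suc k) - b * y k = a ^ k * (y 1 - b * y 0)" for k
    using rec by (rule geom)
  have v: "y (Suc k) - a * y k = b ^ k * (y 1 - a * y 0)" for k
    by (rule geom) (simp add: rec algebra_simps)
  define W V where "W = norm (y 1 - b * y 0)" and "V = norm (y 1 - a * y 0)"
  have ab: "norm (a - b) > 0" using a b by auto
  have le: "(norm a ^ k * W - V) / norm (a - b) \<le> norm (y k)" for k
  proof -
    have "(a - b) * y k = a ^ k * (y 1 - b * y 0) - b ^ k * (y 1 - a * y 0)"
      unfolding w[symmetric] v[symmetric] by (simp add: algebra_simps)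
    then have "norm (a - b) * norm (y k) \<ge> norm a ^ k * W - norm b ^ k * V"
      using norm_triangle_ineq2[of "a ^ k * (y 1 - b * y 0)" "b ^ k * (y 1 - a * y 0)"]
      by (simp only: W_def V_def norm_mult[symmetric] norm_power[symmetric])
    moreover have "norm b ^ k * V \<le> V"
      using b by (simp add: V_def mult_left_le_one_le power_le_one)
    ultimately show ?thesis using ab by (simp add: divide_le_eq mult.commute)
  qed
  have "W > 0" using init by (simp add: W_def)
  have "filterlim (\<lambda>k. norm a ^ k) at_top sequentially"
    using filterlim_at_infinity_imp_norm_at_top[OF filterlim_realpow_sequentially_gt1[OF a]]
    by (simp add: norm_power)
  then have "filterlim (\<lambda>k. W / norm (a - b) * norm a ^ k) at_top sequentially"
    using \<open>W > 0\<close> ab by (intro filterlim_tendsto_pos_mult_at_top[OF tendsto_const]) auto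
  then have "filterlim (\<lambda>k. - (V / norm (a - b)) + W / norm (a - b) * norm a ^ k) at_top sequentially"
    by (rule filterlim_tendsto_add_at_top[OF tendsto_const])
  then show ?thesis
    by (rule filterlim_at_top_mono) (use le in \<open>simp add: diff_divide_distrib mult.commute\<close>)
qed

section \<open>The plane as the complex numbers and the characteristic roots\<close>

definition plane_complex :: "real^2 \<Rightarrow> complex" where
  "plane_complex v = Complex (v $ 1) (v $ 2)"

lemma linear_plane_complex: "linear plane_complex"
  by (auto intro!: linearI simp: plane_complex_def complex_eq_iff)

lemma norm_plane_complex: "norm (plane_complex v) = norm v"
  by (simp add: plane_complex_def cmod_def norm_vec_def L2_set_def sum_2)

lemma plane_complex_rotJ: "plane_complex (rotJ v) = \<i> * plane_complex v"
  by (simp add: plane_complex_def rotJ_def complex_eq_iff)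

lemma plane_complex_surj: "\<exists>v. plane_complex v = z"
  by (rule exI[of _ "vector [Re z, Im z]"]) (simp add: plane_complex_def)

lemma reflected_rotation_diverges:
  assumes s: "lam * L > 1 / sqrt 3"
  obtains V :: "((real^2) \<times> (real^2)) set" where "subspace V" "V \<noteq> UNIV"
    "\<And>xm x. reflected_trajectory (\<lambda>v. L *\<^sub>R rotJ v) lam xm x \<Longrightarrow> (x 0, xm) \<notin> V
       \<Longrightarrow> filterlim (\<lambda>k. norm (x k)) at_top sequentially"
proof -
  define s where "s = lam * L"
  \<comment> \<open>The discriminant of the characteristic polynomial is \<open>1 - 4 * s^2\<close>,
    negative in this range, so its square roots are \<open>\<i> * t\<close> and
    \<open>- \<i> * t\<close>. The larger root \<open>a\<close> has norm exactly 1 at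
    \<open>s = 1 / sqrt 3\<close>.\<close>
  define t where "t = sqrt (4 * s\<^sup>2 - 1)"
  define a b where "a = Complex (1/2) (- (2 * s + t) / 2)" and "b = Complex (1/2) (- (2 * s - t) / 2)"
  have s3: "s > 1 / sqrt 3" using s by (simp add: s_def)
  have "s\<^sup>2 > (1 / sqrt 3)\<^sup>2" using s3 by (intro power_strict_mono) auto
  then have s2: "s\<^sup>2 > 1 / 3" by (simp add: power_divide)
  have t2: "t\<^sup>2 = 4 * s\<^sup>2 - 1" using s2 by (simp add: t_def)
  have "t \<ge> 0" using s2 by (simp add: t_def)
  have "s > 0" using s3 less_trans[of 0 "1 / sqrt 3" s] by simp
  \<comment> \<open>Since \<open>(2 * s + t)^2 = 8 * s^2 - 1 + 4 * (s * t)\<close>, the bounds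
    \<open>s^2 > 1/3\<close> and \<open>s * t > 1/3\<close> make it exceed 3, which is the condition
    \<open>norm a > 1\<close>.\<close>
  have "s * t > 1 / 3"
  proof (rule power_less_imp_less_base[where n = 2])
    have "(1/3) * (1/3) < s\<^sup>2 * t\<^sup>2" using s2 unfolding t2 by (intro mult_strict_mono) auto
    then show "(1/3)\<^sup>2 < (s * t)\<^sup>2" unfolding power_mult_distrib by (simp add: power2_eq_square)
  qed (use \<open>s > 0\<close> \<open>t \<ge> 0\<close> in simp)
  then have p3: "(2 * s + t)\<^sup>2 > 3"
    using s2 t2 by (simp add: power2_sum power_mult_distrib)
  \<comment> \<open>The imaginary parts of the roots have the moduli of reciprocal numbers up to the
    factor 1/2, so a large one for \<open>a\<close> forces a small one for \<open>b\<close>.\<close>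
  have prod: "(2 * s - t) * (2 * s + t) = 1"
    using t2 by (simp add: algebra_simps power2_eq_square)
  have "(norm a)\<^sup>2 = (1 + (2 * s + t)\<^sup>2) / 4"
    unfolding a_def cmod_power2 by (simp add: power2_eq_square field_simps)
  then have "(norm a)\<^sup>2 > 1\<^sup>2" using p3 by simp
  then have na: "norm a > 1" by (rule power_less_imp_less_base) simp
  have "(2 * s - t)\<^sup>2 * (2 * s + t)\<^sup>2 = 1"
    using prod by (metis power_mult_distrib power_one)
  moreover have "(2 * s - t)\<^sup>2 * 3 \<le> (2 * s - t)\<^sup>2 * (2 * s + t)\<^sup>2"
    using p3 by (intro mult_left_mono) auto
  ultimately have "(2 * s - t)\<^sup>2 \<le> 1" by simp
  moreover have "(norm b)\<^sup>2 = (1 + (2 * s - t)\<^sup>2) / 4"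
    unfolding b_def cmod_power2 by (simp add: power2_eq_square field_simps)
  ultimately have "(norm b)\<^sup>2 \<le> 1\<^sup>2" by simp
  then have nb: "norm b \<le> 1" by (rule power2_le_imp_le) simp
  have sum: "a + b = 1 - 2 * \<i> * of_real s" and ab: "a * b = - (\<i> * of_real s)"
    using prod by (simp_all add: a_def b_def complex_eq_iff field_simps)
  interpret c: linear plane_complex by (rule linear_plane_complex)
  \<comment> \<open>The initial data whose solution contains only powers of the small root
    \<open>b\<close>.\<close>
  define V where "V = {w. plane_complex (fst w) = b * plane_complex (snd w)}"
  show ?thesis
  proof
    show "subspace V"
      by (rule subspaceI) (auto simp: V_def c.zero c.add c.scaleR algebra_simps)
    obtain e where "plane_complex e = 1" using plane_complex_surj by blast
    then have "(e, 0) \<notin> V" by (simp add: V_def c.zero)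
    then show "V \<noteq> UNIV" by blast
    fix xm x
    assume tr: "reflected_trajectory (\<lambda>v. L *\<^sub>R rotJ v) lam xm x" and nV: "(x 0, xm) \<notin> V"
    \<comment> \<open>The index is shifted by one: \<open>y 0\<close> stands for the extra starting
      point \<open>xm\<close>, and \<open>y (Suc k)\<close> for \<open>x k\<close>.\<close>
    define y where "y k = plane_complex (case k of 0 \<Rightarrow> xm | Suc j \<Rightarrow> x j)" for k
    have "filterlim (\<lambda>k. norm (y k)) at_top sequentially"
    proof (rule second_order_recurrence_diverges[OF _ na nb])
      show "y 1 \<noteq> b * y 0" using nV by (simp add: y_def V_def)
      fix k
      have "x (Suc k) = x k - s *\<^sub>R rotJ (2 *\<^sub>R x k - (case k of 0 \<Rightarrow> xm | Suc j \<Rightarrow> x j))"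
        using tr by (simp add: reflected_trajectory_def reflected_point_def s_def)
      then have "y (Suc (Suc k)) = y (Suc k) - s *\<^sub>R (\<i> * (2 *\<^sub>R y (Suc k) - y k))"
        by (simp add: y_def c.diff c.scaleR plane_complex_rotJ)
      then show "y (Suc (Suc k)) = (a + b) * y (Suc k) - a * b * y k"
        unfolding sum ab by (simp add: scaleR_conv_of_real algebra_simps)
    qed
    then have "filterlim (\<lambda>k. norm (y (Suc k))) at_top sequentially"
      by (rule filterlim_compose[OF _ filterlim_Suc])
    then show "filterlim (\<lambda>k. norm (x k)) at_top sequentially"
      by (simp add: y_def norm_plane_complex)
  qed
qed

section \<open>Ingredients for the bound on a universal constant\<close>

lemma rotation_mono_lip_class:
  assumes "L \<ge> 0"
  shows "(\<lambda>v. L *\<^sub>R rotJ v) \<in> mono_lip_class L"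
proof -
  interpret c: linear plane_complex by (rule linear_plane_complex)
  have diff: "rotJ x - rotJ y = rotJ (x - y)" for x y
    by (simp add: rotJ_def vec_eq_iff forall_2)
  \<comment> \<open>The rotation is skew, so monotonicity holds with equality.\<close>
  have "rotJ v \<bullet> v = 0" for v by (simp add: rotJ_def inner_vec_def sum_2)
  then have "monotone_operator (\<lambda>v. L *\<^sub>R rotJ v)"
    by (simp add: monotone_operator_def diff flip: scaleR_diff_right)
  moreover have "norm (rotJ v) = norm v" for v
    using norm_plane_complex[of "rotJ v"] by (simp add: plane_complex_rotJ norm_mult norm_plane_complex)
  then have "L-lipschitz_on UNIV (\<lambda>v. L *\<^sub>R rotJ v)"
    using assms by (auto intro!: lipschitz_onI simp: dist_norm diff simp flip: scaleR_diff_right)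
  moreover have "L *\<^sub>R rotJ 0 = 0" by (simp add: rotJ_def vec_eq_iff forall_2)
  ultimately show ?thesis by (auto simp: mono_lip_class_def)
qed

lemma reflected_trajectory_exists:
  obtains x where "reflected_trajectory B lam xm x" "x 0 = x0"
proof -
  \<comment> \<open>The scheme becomes a first-order iteration on pairs of current and previous
    iterate.\<close>
  define f where "f w = (fst w - lam *\<^sub>R B (2 *\<^sub>R fst w - snd w), fst w)" for w
  define x where "x k = fst ((f ^^ k) (x0, xm))" for k
  have "snd ((f ^^ k) (x0, xm)) = (case k of 0 \<Rightarrow> xm | Suc j \<Rightarrow> x j)" for k
    by (cases k) (simp_all add: x_def f_def)
  then have "x (Suc k) = x k - lam *\<^sub>R B (reflected_point xm x k)" for k
    unfolding reflected_point_def by (metis (no_types, lifting) x_def f_def fst_conv comp_apply funpow.simps(2))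
  then have "reflected_trajectory B lam xm x" by (simp add: reflected_trajectory_def)
  moreover have "x 0 = x0" by (simp add: x_def)
  ultimately show ?thesis using that by blast
qed

text \<open>In finite dimension, convergence of the coordinates gives convergence in norm, so the
  norms have a finite limit.\<close>

lemma weakly_converges_not_norm_at_top:
  fixes x :: "nat \<Rightarrow> 'a::euclidean_space"
  assumes "weakly_converges x p"
  shows "\<not> filterlim (\<lambda>k. norm (x k)) at_top sequentially"
proof -
  have "(\<lambda>k. \<Sum>b\<in>Basis. (x k \<bullet> b) *\<^sub>R b) \<longlonglongrightarrow> (\<Sum>b\<in>Basis. (p \<bullet> b) *\<^sub>R b)"
    using assms by (intro tendsto_sum tendsto_scaleR tendsto_const) (simp add: weakly_converges_def)
  then have "(\<lambda>k. norm (x k)) \<longlonglongrightarrow> norm p"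
    by (simp add: euclidean_representation tendsto_norm)
  then show ?thesis using not_tendsto_and_filterlim_at_infinity filterlim_at_top_imp_at_infinity
    by (metis sequentially_bot)
qed

section \<open>Sharpness and conditional convergence combined\<close>

theorem theorem10p4:
  fixes L :: real
  assumes "L > 0"
  shows
    "(\<forall>lam > 1 / (sqrt 3 * L).
        \<exists>V :: ((real^2) \<times> (real^2)) set. subspace V \<and> V \<noteq> UNIV \<and>
          (\<forall>xm x. reflected_trajectory (\<lambda>v. L *\<^sub>R rotJ v) lam xm x \<and> (x 0, xm) \<notin> V
             \<longrightarrow> filterlim (\<lambda>k. norm (x k)) at_top sequentially))
     \<and>
     \<not> (\<exists>c > 1 / sqrt 3. \<forall>B \<in> (mono_lip_class L :: (real^2 \<Rightarrow> real^2) set).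
           \<forall>lam. 0 < lam \<and> lam < c / L \<longrightarrow>
             (\<forall>xm x. reflected_trajectory B lam xm x \<longrightarrow> (\<exists>p. weakly_converges x p)))
     \<and>
     (\<forall>B \<in> (mono_lip_class L :: ('a::{real_inner, complete_space} \<Rightarrow> 'a) set).
        \<forall>lam. 0 < lam \<and> lam < 1 / (sqrt 3 * L) \<longrightarrow>
          (\<forall>xm x. reflected_trajectory B lam xm x \<and>
                  summable (\<lambda>k. (norm (B (reflected_point xm x k)))\<^sup>2) \<longrightarrow>
             (\<exists>p \<in> {z. B z = 0}. weakly_converges x p) \<and>
             (\<lambda>k. norm (x (Suc k) - x k)) \<longlonglongrightarrow> 0 \<and>
             (\<lambda>k. B (x k)) \<longlonglongrightarrow> 0))"
proof (intro conjI allI impI ballI)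
  have big: "lam * L > 1 / sqrt 3" if "lam > 1 / (sqrt 3 * L)" for lam
    using that \<open>L > 0\<close> by (simp add: field_simps)
  fix lam assume "lam > 1 / (sqrt 3 * L)"
  from big[OF this] obtain V :: "((real^2) \<times> (real^2)) set" where "subspace V" "V \<noteq> UNIV"
    "\<And>xm x. reflected_trajectory (\<lambda>v. L *\<^sub>R rotJ v) lam xm x \<Longrightarrow> (x 0, xm) \<notin> V
       \<Longrightarrow> filterlim (\<lambda>k. norm (x k)) at_top sequentially"
    by (rule reflected_rotation_diverges) blast
  then show "\<exists>V :: ((real^2) \<times> (real^2)) set. subspace V \<and> V \<noteq> UNIV \<and>
      (\<forall>xm x. reflected_trajectory (\<lambda>v. L *\<^sub>R rotJ v) lam xm x \<and> (x 0, xm) \<notin> V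
        \<longrightarrow> filterlim (\<lambda>k. norm (x k)) at_top sequentially)"
    by blast
next
  show "\<not> (\<exists>c > 1 / sqrt 3. \<forall>B \<in> (mono_lip_class L :: (real^2 \<Rightarrow> real^2) set).
      \<forall>lam. 0 < lam \<and> lam < c / L \<longrightarrow>
        (\<forall>xm x. reflected_trajectory B lam xm x \<longrightarrow> (\<exists>p. weakly_converges x p)))"
  proof
    assume "\<exists>c > 1 / sqrt 3. \<forall>B \<in> (mono_lip_class L :: (real^2 \<Rightarrow> real^2) set).
      \<forall>lam. 0 < lam \<and> lam < c / L \<longrightarrow>
        (\<forall>xm x. reflected_trajectory B lam xm x \<longrightarrow> (\<exists>p. weakly_converges x p))"
    then obtain c where c: "c > 1 / sqrt 3"
      and all: "\<And>B lam xm x. B \<in> (mono_lip_class L :: (real^2 \<Rightarrow> real^2) set) \<Longrightarrow> 0 < lam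
        \<Longrightarrow> lam < c / L \<Longrightarrow> reflected_trajectory B lam xm x \<Longrightarrow> \<exists>p. weakly_converges x p"
      by blast
    \<comment> \<open>Any \<open>s\<close> strictly between the threshold and \<open>c\<close> gives
      a step size \<open>s / L\<close> that is admissible for \<open>c\<close> yet divergent for the
      rotation.\<close>
    obtain s where s: "1 / sqrt 3 < s" "s < c" using dense[OF c] by blast
    have "0 < s" using s(1) less_trans[of 0 "1 / sqrt 3" s] by simp
    define lam where "lam = s / L"
    have "lam * L = s" using \<open>L > 0\<close> by (simp add: lam_def)
    then have "lam * L > 1 / sqrt 3" using s by simp
    then obtain V :: "((real^2) \<times> (real^2)) set" where V: "V \<noteq> UNIV"
      "\<And>xm x. reflected_trajectory (\<lambda>v. L *\<^sub>R rotJ v) lam xm x \<Longrightarrow> (x 0, xm) \<notin> V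
         \<Longrightarrow> filterlim (\<lambda>k. norm (x k)) at_top sequentially"
      by (rule reflected_rotation_diverges) blast
    obtain x0 xm where nV: "(x0, xm) \<notin> V" using V(1) by auto
    obtain x where x: "reflected_trajectory (\<lambda>v. L *\<^sub>R rotJ v) lam xm x" "x 0 = x0"
      by (rule reflected_trajectory_exists)
    have "\<exists>p. weakly_converges x p"
      using \<open>L > 0\<close> \<open>0 < s\<close> s
      by (intro all[OF rotation_mono_lip_class _ _ x(1)]) (auto simp: lam_def divide_strict_right_mono)
    then show False using V(2)[OF x(1)] nV x(2) weakly_converges_not_norm_at_top by auto
  qed
next
  fix B :: "'a \<Rightarrow> 'a" and lam xm x
  assume B: "B \<in> mono_lip_class L" and lam: "0 < lam \<and> lam < 1 / (sqrt 3 * L)"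
    and x: "reflected_trajectory B lam xm x \<and>
      summable (\<lambda>k. (norm (B (reflected_point xm x k)))\<^sup>2)"
  note conv = reflected_summable_converges[of B L lam xm x]
  show "\<exists>p\<in>{z. B z = 0}. weakly_converges x p" using conv(1) B lam x by simp
  show "(\<lambda>k. norm (x (Suc k) - x k)) \<longlonglongrightarrow> 0" using conv(2) B lam x by simp
  show "(\<lambda>k. B (x k)) \<longlonglongrightarrow> 0" using conv(3) B lam x by simp
qed

end
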